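(* Let $A=(a_{ni})$ be a non-negative regular summability matrix and let $(\alpha_n)_{n\in\mathbb{N}}$ be a sequence with $0\le\alpha_n\le\frac1n$. Then for each $f\in C_w^k[0,\infty)$, $$st_A\text{-}\lim_{n\to\infty}\left\|\mathcal{U}_{n}^{[\alpha_n]}(f;\cdot)-f\right\|_{w}=0.$$
   Context: For $n\in\mathbb{N}$, $0\le\alpha\le\frac1n$, $x\ge 0$ and a function $f$ on $[0,\infty)$ for which the expression converges absolutely, define $$\mathcal{U}_{n}^{[\alpha]}(f;x)=n\sum_{i=0}^{\infty}(1+n\alpha)^{-x/\alpha}\Big(\alpha+\frac1n\Big)^{-i}\frac{x^{(i,-\alpha)}}{i!}\int_0^\infty e^{-nu}\frac{(nu)^i}{i!}f(u)\,du,$$ with $x^{(0,-\alpha)}=1$ and $x^{(i,-\alpha)}=x(x+\alpha)\cdots(x+(i-1)\alpha)$; for $\alpha=0$ the coefficient is understood as its limit as $\alpha\to0$, namely $e^{-nx}\frac{(nx)^i}{i!}$. Let $w(x)=1+x^2$ and $\|f\|_w=\sup_{x\ge0}\frac{|f(x)|}{w(x)}$. $C_w^k[0,\infty)$ is the set of continuous $f:[0,\infty)\to\mathbb{R}$ with $\|f\|_w<\infty$ for which $\lim_{x\to\infty}\frac{|f(x)|}{w(x)}$ exists and is finite. An infinite matrix $A=(a_{ni})$ with non-negative entries is a regular summability matrix if, for every sequence $(x_i)$ with $\lim_i x_i=\sigma$, the $A$-transform $\sum_i a_{ni}x_i$ converges for each $n$ and $\lim_{n\to\infty}\sum_i a_{ni}x_i=\sigma$.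 A sequence $(x_i)$ is $A$-statistically convergent to $\sigma$, written $st_A\text{-}\lim x_i=\sigma$, if for every $\epsilon>0$, $\lim_{n\to\infty}\sum_{i:\,|x_i-\sigma|\ge\epsilon}a_{ni}=0$. *)

theory Defs
  imports "HOL-Analysis.Analysis"
begin

text \<open>
  All sequences, matrices and operators are indexed by the positive integers; values at
  index \<open>0\<close> are never used. Functions on \<open>[0,\<infinity>)\<close> are total functions on the reals of which
  only the values at non-negative arguments are used.
\<close>

definition rising_step :: "real \<Rightarrow> nat \<Rightarrow> real \<Rightarrow> real" where
  "rising_step x i \<alpha> = (\<Prod>j<i. x + real j * \<alpha>)"

text \<open>The value at \<open>\<alpha> = 0\<close> is the limit of the general expression as \<open>\<alpha>\<close> tends to \<open>0\<close>.\<close>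

definition U_coeff :: "nat \<Rightarrow> real \<Rightarrow> nat \<Rightarrow> real \<Rightarrow> real" where
  "U_coeff n \<alpha> i x =
    (if \<alpha> = 0 then exp (- (real n * x)) * (real n * x) ^ i / fact i
     else (1 + real n * \<alpha>) powr (- x / \<alpha>) * inverse (\<alpha> + 1 / real n) ^ i
            * rising_step x i \<alpha> / fact i)"

definition U_op :: "nat \<Rightarrow> real \<Rightarrow> (real \<Rightarrow> real) \<Rightarrow> real \<Rightarrow> real" where
  "U_op n \<alpha> f x =
    real n * (\<Sum>i. U_coeff n \<alpha> i x *
      (LINT u:{0..}|lborel. exp (- (real n * u)) * (real n * u) ^ i / fact i * f u))"

definition w :: "real \<Rightarrow> real" where
  "w x = 1 + x\<^sup>2"

text \<open>The supremum is extended-real valued, hence \<open>\<infinity>\<close> for unbounded quotients.\<close>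

definition w_norm :: "(real \<Rightarrow> real) \<Rightarrow> ereal" where
  "w_norm f = (SUP x\<in>{0..}. ereal (\<bar>f x\<bar> / w x))"

definition C_w_k :: "(real \<Rightarrow> real) set" where
  "C_w_k = {f. continuous_on {0..} f \<and> w_norm f < \<infinity> \<and>
               (\<exists>L. ((\<lambda>x. \<bar>f x\<bar> / w x) \<longlongrightarrow> L) at_top)}"

definition regular_summability_matrix :: "(nat \<Rightarrow> nat \<Rightarrow> real) \<Rightarrow> bool" where
  "regular_summability_matrix A \<longleftrightarrow>
    (\<forall>n\<ge>1. \<forall>i\<ge>1. 0 \<le> A n i) \<and>
    (\<forall>x \<sigma>. x \<longlonglongrightarrow> \<sigma> \<longrightarrow>
       (\<forall>n\<ge>1. summable (\<lambda>i. A n (Suc i) * x (Suc i))) \<and>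
       (\<lambda>n. \<Sum>i. A n (Suc i) * x (Suc i)) \<longlonglongrightarrow> \<sigma>)"

text \<open>
  Sequences may take infinite values, since norms are extended reals: an infinite term
  counts as being at distance at least \<open>\<epsilon>\<close> from the finite limit \<open>\<sigma>\<close>.
\<close>

definition A_stat_lim :: "(nat \<Rightarrow> nat \<Rightarrow> real) \<Rightarrow> (nat \<Rightarrow> ereal) \<Rightarrow> real \<Rightarrow> bool" where
  "A_stat_lim A x \<sigma> \<longleftrightarrow>
    (\<forall>\<epsilon>::real. \<epsilon> > 0 \<longrightarrow>
       (\<lambda>n. \<Sum>\<^sub>\<infinity>i\<in>{i. 1 \<le> i \<and> ereal \<epsilon> \<le> \<bar>x i - ereal \<sigma>\<bar>}. A n i) \<longlonglongrightarrow> 0)"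

end

theory Submission
  imports Defs "HOL-Probability.Distributions"
begin

text \<open>
  The operator averages \<open>f\<close> over a random point \<open>u\<close>: first \<open>i\<close> is drawn from a negative
  binomial (for \<open>\<alpha> = 0\<close>, Poisson) distribution, then \<open>u\<close> from the Erlang distribution with
  shape \<open>i + 1\<close> and rate \<open>n\<close>. The mean of \<open>(u - x)\<^sup>2\<close> is \<open>\<alpha> x + 2 x / n + 2 / n\<^sup>2\<close>, which is
  at most \<open>5 w x / n\<close> uniformly in \<open>\<alpha> \<le> 1 / n\<close>. Every \<open>f\<close> in the weighted space satisfies
  \<open>\<bar>f u - f x\<bar> \<le> \<epsilon> w x + K (u - x)\<^sup>2\<close> with \<open>K\<close> depending only on \<open>f\<close> and \<open>\<epsilon>\<close>; averaging this
  bound gives convergence of the norms in the ordinary sense. Hence only finitely many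
  indices are exceptional, and each column of a regular summability matrix tends to \<open>0\<close>.
\<close>

section \<open>The weight and a quadratic modulus for functions in the weighted space\<close>

lemma w_pos: "0 < w x"
  and w_ge_1: "1 \<le> w x"
  by (auto simp: w_def add_pos_nonneg)

lemma continuous_on_w [continuous_intros]: "continuous_on S w"
  unfolding w_def by (intro continuous_intros)

text \<open>If \<open>L\<close> is nonzero, \<open>h\<close> eventually has no zero and hence, being
  continuous, a constant sign. \<open>C_w_k\<close> only controls \<bar>f\<bar> / w, while the later
  decomposition needs a limit of the signed quotient.\<close>

lemma tendsto_of_tendsto_abs:
  fixes h :: "real \<Rightarrow> real"
  assumes cont: "continuous_on {a..} h" and lim: "((\<lambda>x. \<bar>h x\<bar>) \<longlongrightarrow> L) at_top"
  shows "\<exists>c. (h \<longlongrightarrow> c) at_top"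
proof (cases "L = 0")
  case True
  then show ?thesis using lim tendsto_rabs_zero_iff by blast
next
  case False
  have "0 \<le> L"
    by (rule tendsto_lowerbound[OF lim]) auto
  with False have "eventually (\<lambda>x. 0 < \<bar>h x\<bar>) at_top"
    by (intro order_tendstoD(1)[OF lim]) auto
  then obtain M where M: "\<And>x. x \<ge> M \<Longrightarrow> 0 < \<bar>h x\<bar>"
    by (auto simp: eventually_at_top_linorder)
  define b where "b = max a M"
  have nz: "h x \<noteq> 0" if "x \<ge> b" for x
    using M[of x] that by (auto simp: b_def)
  have "continuous_on {b..} h"
    by (rule continuous_on_subset[OF cont]) (auto simp: b_def)
  then have conn: "connected (h ` {b..})"
    by (intro connected_continuous_image convex_connected) auto
  have "(\<forall>x\<ge>b. h x > 0) \<or> (\<forall>x\<ge>b. h x < 0)"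
  proof (rule ccontr)
    assume "\<not> ?thesis"
    then obtain x y where "x \<ge> b" "h x \<le> 0" "y \<ge> b" "h y \<ge> 0"
      by (meson not_less)
    \<comment> \<open>Intermediate value theorem: values of both signs force a zero.\<close>
    then have "0 \<in> h ` {b..}"
      using connectedD_interval[OF conn, of "h x" "h y" 0] by auto
    then show False using nz by auto
  qed
  then have "eventually (\<lambda>x. \<bar>h x\<bar> = h x) at_top \<or> eventually (\<lambda>x. \<bar>h x\<bar> = - h x) at_top"
    unfolding eventually_at_top_linorder by (meson abs_of_neg abs_of_pos)
  then have "(h \<longlongrightarrow> L) at_top \<or> ((\<lambda>x. - h x) \<longlongrightarrow> L) at_top"
    by (elim disjE) (simp_all add: lim Lim_transform_eventually[OF lim])
  then show ?thesis
    using tendsto_minus_cancel_left[of h L at_top] by blast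
qed

text \<open>Three regimes cover all pairs: if both points are large, the weights dominate; if both
  lie in a compact interval, uniform continuity or boundedness applies; otherwise the points are
  more than 1 apart and the quadratic term absorbs the bounded value.\<close>

lemma little_o_w_modulus:
  assumes cont: "continuous_on {0..} g" and lim: "((\<lambda>x. g x / w x) \<longlongrightarrow> 0) at_top"
    and \<eta>: "\<eta> > 0"
  shows "\<exists>K\<ge>0. \<forall>u\<ge>0. \<forall>x\<ge>0. \<bar>g u - g x\<bar> \<le> \<eta> * (w u + w x) + K * (u - x)\<^sup>2"
proof -
  have "eventually (\<lambda>x. \<bar>g x / w x\<bar> < \<eta>) at_top"
    using tendstoD[OF lim \<eta>] by (simp add: dist_real_def)
  then obtain M0 where "\<And>x. x \<ge> M0 \<Longrightarrow> \<bar>g x / w x\<bar> < \<eta>"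
    by (auto simp: eventually_at_top_linorder)
  then have M0: "\<bar>g x\<bar> \<le> \<eta> * w x" if "x \<ge> M0" for x
    using that w_pos[of x] by (force simp: divide_simps)
  define M where "M = max 0 M0"
  have M: "\<bar>g x\<bar> \<le> \<eta> * w x" if "x \<ge> M" for x
    using M0 that by (auto simp: M_def)
  \<comment> \<open>The margin of 1 beyond \<open>M\<close> makes (u - x)^2 \<ge> 1 whenever one
    point is below \<open>M\<close> and the other lies outside the interval.\<close>
  have cont': "continuous_on {0..M+1} g"
    by (rule continuous_on_subset[OF cont]) auto
  have "bounded (g ` {0..M+1})"
    by (intro compact_imp_bounded compact_continuous_image cont') auto
  then have "\<exists>G>0. \<forall>x\<in>{0..M+1}. \<bar>g x\<bar> \<le> G"
    unfolding bounded_pos by simp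
  then obtain G where G: "\<And>x. 0 \<le> x \<Longrightarrow> x \<le> M + 1 \<Longrightarrow> \<bar>g x\<bar> \<le> G" "0 < G"
    by (meson atLeastAtMost_iff)
  have "uniformly_continuous_on {0..M+1} g"
    by (intro compact_uniformly_continuous cont') auto
  then obtain d where d: "d > 0"
    and uc: "\<And>u x. 0 \<le> u \<Longrightarrow> u \<le> M + 1 \<Longrightarrow> 0 \<le> x \<Longrightarrow> x \<le> M + 1 \<Longrightarrow> \<bar>u - x\<bar> < d \<Longrightarrow> \<bar>g u - g x\<bar> < \<eta>"
    unfolding uniformly_continuous_on_def using \<eta> by (metis atLeastAtMost_iff dist_real_def)
  \<comment> \<open>The first summand pays for pairs in the interval at distance at least
    \<open>d\<close>, where the oscillation is at most \<open>2 * G\<close>; the second pays for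
    \<open>g x\<close> when \<open>x < M\<close> and \<open>u > M + 1\<close>.\<close>
  define K where "K = 2 * G / d\<^sup>2 + G"
  have K: "2 * G / d\<^sup>2 \<le> K" "G \<le> K" "0 \<le> K"
    using G(2) d by (auto simp: K_def)
  \<comment> \<open>The bound is symmetric in the two points, so the ordered case suffices.\<close>
  have main: "\<bar>g u - g x\<bar> \<le> \<eta> * (w u + w x) + K * (u - x)\<^sup>2" if "0 \<le> x" "x \<le> u" for u x
  proof -
    have nn: "0 \<le> \<eta> * w u" "0 \<le> \<eta> * w x" "0 \<le> K * (u - x)\<^sup>2"
      using \<eta> w_pos[of u] w_pos[of x] K by auto
    consider "x \<ge> M" | "u \<le> M + 1" | "x < M" "u > M + 1" by linarith
    then show ?thesis
    proof cases
      case 1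
      then show ?thesis using M[of x] M[of u] that nn by (simp add: distrib_left)
    next
      case 2
      show ?thesis
      proof (cases "\<bar>u - x\<bar> < d")
        case True
        have "\<eta> \<le> \<eta> * w u" using \<eta> w_ge_1[of u] by simp
        then show ?thesis using uc[of u x] True that 2 nn by (simp add: distrib_left)
      next
        case False
        then have "d\<^sup>2 \<le> (u - x)\<^sup>2"
          using d that by (intro power_mono) auto
        then have "2 * G \<le> 2 * G / d\<^sup>2 * (u - x)\<^sup>2"
          using d G(2) by (simp add: field_simps)
        also have "\<dots> \<le> K * (u - x)\<^sup>2" by (rule mult_right_mono[OF K(1)]) simp
        finally show ?thesis
          using G(1)[of u] G(1)[of x] that 2 nn by (simp add: distrib_left)
      qed
    next
      case 3
      then have "1\<^sup>2 \<le> (u - x)\<^sup>2" by (intro power_mono) auto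
      then have "G \<le> G * (u - x)\<^sup>2" using G(2) by simp
      also have "\<dots> \<le> K * (u - x)\<^sup>2" by (rule mult_right_mono[OF K(2)]) simp
      finally show ?thesis
        using G(1)[of x] M[of u] that 3 nn by (simp add: distrib_left)
    qed
  qed
  show ?thesis
  proof (intro exI[of _ K] conjI allI impI K)
    fix u x :: real assume "0 \<le> u" "0 \<le> x"
    then show "\<bar>g u - g x\<bar> \<le> \<eta> * (w u + w x) + K * (u - x)\<^sup>2"
      using main[of x u] main[of u x]
      by (cases "x \<le> u") (auto simp: abs_minus_commute power2_commute add.commute)
  qed
qed

text \<open>The difference is (u - x)^2 plus the cross term 2 x (u - x), which the weighted
  arithmetic-geometric inequality splits. Only the weight at \<open>x\<close> remains on the right,
  as the norm estimate requires.\<close>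

lemma w_diff_bound:
  assumes "\<eta> > 0"
  shows "\<bar>w u - w x\<bar> \<le> \<eta> * w x + (1 + 1 / \<eta>) * (u - x)\<^sup>2"
proof -
  have expand: "(\<eta> * a - b)\<^sup>2 / \<eta> = \<eta> * a\<^sup>2 - 2 * (a * b) + b\<^sup>2 / \<eta>" for a b :: real
    using assms by (simp add: power2_eq_square field_simps)
  have "0 \<le> (\<eta> * \<bar>x\<bar> - \<bar>u - x\<bar>)\<^sup>2 / \<eta>" using assms by simp
  also have "\<dots> = \<eta> * \<bar>x\<bar>\<^sup>2 - 2 * (\<bar>x\<bar> * \<bar>u - x\<bar>) + \<bar>u - x\<bar>\<^sup>2 / \<eta>"
    by (rule expand)
  also have "\<dots> = \<eta> * x\<^sup>2 - 2 * \<bar>x * (u - x)\<bar> + (u - x)\<^sup>2 / \<eta>"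
    by (simp add: abs_mult)
  finally have 1: "2 * \<bar>x * (u - x)\<bar> \<le> \<eta> * x\<^sup>2 + (u - x)\<^sup>2 / \<eta>" by simp
  have "w u - w x = (u - x)\<^sup>2 + 2 * (x * (u - x))"
    by (simp add: w_def power2_eq_square algebra_simps)
  then have "\<bar>w u - w x\<bar> \<le> (u - x)\<^sup>2 + 2 * \<bar>x * (u - x)\<bar>"
    using zero_le_power2[of "u - x"] by linarith
  with 1 assms show ?thesis by (simp add: w_def algebra_simps)
qed

text \<open>Split f = c w + g, where c is the signed limit of f / w. Then g is of smaller order than
  w, and each part has its own quadratic modulus.\<close>

lemma weighted_modulus:
  assumes f: "f \<in> C_w_k" and \<epsilon>: "\<epsilon> > 0"
  shows "\<exists>K\<ge>0. \<forall>u\<ge>0. \<forall>x\<ge>0. \<bar>f u - f x\<bar> \<le> \<epsilon> * w x + K * (u - x)\<^sup>2"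
proof -
  have cont: "continuous_on {0..} f" using f by (simp add: C_w_k_def)
  obtain L where "((\<lambda>x. \<bar>f x\<bar> / w x) \<longlongrightarrow> L) at_top"
    using f by (auto simp: C_w_k_def)
  then have "((\<lambda>x. \<bar>f x / w x\<bar>) \<longlongrightarrow> L) at_top"
    using w_pos by (simp add: abs_divide abs_of_pos)
  moreover have "continuous_on {0..} (\<lambda>x. f x / w x)"
    using w_pos by (intro continuous_intros cont) (auto simp: less_imp_neq[symmetric])
  ultimately obtain c where c: "((\<lambda>x. f x / w x) \<longlongrightarrow> c) at_top"
    using tendsto_of_tendsto_abs by blast
  define g where "g = (\<lambda>x. f x - c * w x)"
  have "(\<lambda>x. g x / w x) = (\<lambda>x. f x / w x - c)"
    using w_pos by (auto simp: g_def diff_divide_distrib less_imp_neq[symmetric])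
  then have "((\<lambda>x. g x / w x) \<longlongrightarrow> 0) at_top"
    using c by (simp add: LIM_zero_iff)
  moreover have "continuous_on {0..} g"
    unfolding g_def by (intro continuous_intros cont)
  \<comment> \<open>The weight at \<open>u\<close> is later replaced by \<open>2 * w x\<close> plus
    a quadratic term, so \<open>g\<close> costs 3 \<eta> = \<epsilon> / 2 times
    \<open>w x\<close>.\<close>
  moreover define \<eta> where "\<eta> = \<epsilon> / 6"
  have \<eta>: "\<eta> > 0" using \<epsilon> by (simp add: \<eta>_def)
  ultimately obtain K where K: "K \<ge> 0"
    and gK: "\<And>u x. u \<ge> 0 \<Longrightarrow> x \<ge> 0 \<Longrightarrow> \<bar>g u - g x\<bar> \<le> \<eta> * (w u + w x) + K * (u - x)\<^sup>2"
    using little_o_w_modulus[of g \<eta>] by blast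
  \<comment> \<open>The part \<open>c * w\<close> may use the other half of \<epsilon>; adding 1 to
    \<bar>c\<bar> covers c = 0.\<close>
  define \<theta> where "\<theta> = \<epsilon> / (2 * (\<bar>c\<bar> + 1))"
  have \<theta>: "\<theta> > 0" using \<epsilon> by (simp add: \<theta>_def)
  have c\<theta>: "\<bar>c\<bar> * \<theta> \<le> \<epsilon> / 2"
    using \<epsilon> by (simp add: \<theta>_def field_simps)
  define K' where "K' = 2 * \<eta> + K + \<bar>c\<bar> * (1 + 1 / \<theta>)"
  have "K' \<ge> 0" using \<eta> K \<theta> by (simp add: K'_def)
  moreover have "\<bar>f u - f x\<bar> \<le> \<epsilon> * w x + K' * (u - x)\<^sup>2" if "u \<ge> 0" "x \<ge> 0" for u x
  proof -
    have "f u - f x = (g u - g x) + c * (w u - w x)"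
      by (simp add: g_def algebra_simps)
    then have "\<bar>f u - f x\<bar> \<le> \<bar>g u - g x\<bar> + \<bar>c\<bar> * \<bar>w u - w x\<bar>"
      by (metis abs_mult abs_triangle_ineq)
    also have "\<dots> \<le> (\<eta> * (w u + w x) + K * (u - x)\<^sup>2) + \<bar>c\<bar> * (\<theta> * w x + (1 + 1 / \<theta>) * (u - x)\<^sup>2)"
      by (intro add_mono mult_left_mono gK that w_diff_bound \<theta>) auto
    \<comment> \<open>The case \<eta> = 1 of \<open>w_diff_bound\<close>; it removes the weight at
      \<open>u\<close>.\<close>
    also have "w u \<le> 2 * w x + 2 * (u - x)\<^sup>2"
      using w_diff_bound[of 1 u x] by simp
    then have "\<eta> * (w u + w x) \<le> \<eta> * (3 * w x + 2 * (u - x)\<^sup>2)"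
      using \<eta> by (intro mult_left_mono) auto
    also have "(\<eta> * (3 * w x + 2 * (u - x)\<^sup>2) + K * (u - x)\<^sup>2) + \<bar>c\<bar> * (\<theta> * w x + (1 + 1 / \<theta>) * (u - x)\<^sup>2)
        = (\<epsilon> / 2 + \<bar>c\<bar> * \<theta>) * w x + K' * (u - x)\<^sup>2"
      by (simp add: K'_def \<eta>_def algebra_simps)
    also have "(\<epsilon> / 2 + \<bar>c\<bar> * \<theta>) * w x \<le> \<epsilon> * w x"
      using c\<theta> w_pos[of x] by (intro mult_right_mono) auto
    finally show ?thesis by simp
  qed
  ultimately show ?thesis by blast
qed

section \<open>Total mass and first two moments of the coefficients\<close>

lemma U_coeff_nonneg:
  assumes "0 \<le> \<alpha>" "0 \<le> x"
  shows "0 \<le> U_coeff n \<alpha> i x"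
  using assms by (auto simp: U_coeff_def rising_step_def intro!: mult_nonneg_nonneg divide_nonneg_nonneg prod_nonneg)

lemma rising_step_pochhammer:
  "\<alpha> \<noteq> 0 \<Longrightarrow> rising_step x i \<alpha> = \<alpha> ^ i * pochhammer (x / \<alpha>) i"
  by (induction i) (auto simp: rising_step_def pochhammer_Suc field_simps)

text \<open>For \<open>\<alpha> > 0\<close> the coefficients are the negative binomial weights with
  parameters \<open>x / \<alpha>\<close> and \<open>q = n \<alpha> / (1 + n \<alpha>)\<close>.\<close>

lemma U_coeff_sums_1:
  assumes n: "n \<ge> 1" and \<alpha>: "0 \<le> \<alpha>"
  shows "(\<lambda>i. U_coeff n \<alpha> i x) sums 1"
proof (cases "\<alpha> = 0")
  case True
  have "(\<lambda>i. exp (- (real n * x)) * ((real n * x) ^ i /\<^sub>R fact i)) sums (exp (- (real n * x)) * exp (real n * x))"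
    by (intro sums_mult exp_converges)
  moreover have "exp (- (real n * x)) * exp (real n * x) = 1"
    by (simp flip: exp_add)
  ultimately show ?thesis
    using True by (simp add: U_coeff_def field_simps)
next
  case False
  define q where "q = real n * \<alpha> / (1 + real n * \<alpha>)"
  have na: "0 < real n * \<alpha>" using n \<alpha> False by simp
  then have q: "0 < q" "q < 1" "1 - q = inverse (1 + real n * \<alpha>)"
    by (auto simp: q_def field_simps)
  \<comment> \<open>Newton's binomial series with negative exponent; the sign of the generalized
    binomial coefficient cancels against the sign in the power of \<open>- q\<close>.\<close>
  have "(\<lambda>i. ((- (x / \<alpha>)) gchoose i) * (- q) ^ i) sums (1 + - q) powr (- (x / \<alpha>))"
    using q by (intro gen_binomial_real) auto
  moreover have "((- (x / \<alpha>)) gchoose i) * (- q) ^ i = pochhammer (x / \<alpha>) i * q ^ i / fact i" for i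
  proof -
    have "((- (x / \<alpha>)) gchoose i) * (- q) ^ i = ((- 1) ^ i * (- 1) ^ i) * (pochhammer (x / \<alpha>) i * q ^ i / fact i)"
      unfolding gbinomial_pochhammer power_minus[of q] minus_minus times_divide_eq_left times_divide_eq_right
      by (simp only: mult_ac)
    also have "(- 1 :: real) ^ i * (- 1) ^ i = 1"
      by (simp flip: power_mult_distrib)
    finally show ?thesis by simp
  qed
  ultimately have "(\<lambda>i. pochhammer (x / \<alpha>) i * q ^ i / fact i) sums (1 - q) powr (- (x / \<alpha>))"
    by simp
  then have "(\<lambda>i. (1 + real n * \<alpha>) powr (- x / \<alpha>) * (pochhammer (x / \<alpha>) i * q ^ i / fact i)) sums
      ((1 + real n * \<alpha>) powr (- x / \<alpha>) * (1 - q) powr (- (x / \<alpha>)))"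
    by (rule sums_mult)
  moreover have "(1 + real n * \<alpha>) powr (- x / \<alpha>) * (1 - q) powr (- (x / \<alpha>)) = 1"
    using na by (simp add: q(3) powr_minus inverse_powr flip: powr_add)
  moreover have "(1 + real n * \<alpha>) powr (- x / \<alpha>) * (pochhammer (x / \<alpha>) i * q ^ i / fact i) = U_coeff n \<alpha> i x" for i
  proof -
    have "q = inverse (\<alpha> + 1 / real n) * \<alpha>"
      using n na by (simp add: q_def field_simps)
    then show ?thesis
      using False by (simp add: U_coeff_def rising_step_pochhammer power_mult_distrib)
  qed
  ultimately show ?thesis by simp
qed

text \<open>Iterating this shift relation yields all factorial moments of the coefficients.\<close>

lemma U_coeff_Suc:
  assumes n: "n \<ge> 1" and \<alpha>: "0 \<le> \<alpha>"
  shows "real (Suc i) * U_coeff n \<alpha> (Suc i) x = real n * x * U_coeff n \<alpha> i (x + \<alpha>)"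
proof (cases "\<alpha> = 0")
  case True
  have "real (Suc i) * (c / fact (Suc i)) = c / fact i" for c :: real
    by (simp del: of_nat_Suc)
  from this[of "exp (- (real n * x)) * (real n * x) ^ Suc i"] True show ?thesis
    by (simp add: U_coeff_def)
next
  case False
  have na: "0 < 1 + real n * \<alpha>" using n \<alpha> by (simp add: add_pos_nonneg)
  \<comment> \<open>Passing from x to x + \<alpha> releases one factor
    \<open>1 + real n * \<alpha>\<close>, which combines with one factor
    \<open>inverse (\<alpha> + 1 / real n)\<close> to give \<open>real n\<close>.\<close>
  have "(1 + real n * \<alpha>) powr (- x / \<alpha>) = (1 + real n * \<alpha>) powr (- (x + \<alpha>) / \<alpha> + 1)"
    using False by (simp add: field_simps)
  also have "\<dots> = (1 + real n * \<alpha>) powr (- (x + \<alpha>) / \<alpha>) * (1 + real n * \<alpha>)"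
    using na by (simp add: powr_add)
  finally have 1: "(1 + real n * \<alpha>) powr (- x / \<alpha>) = \<dots>" .
  have 2: "(1 + real n * \<alpha>) * inverse (\<alpha> + 1 / real n) = real n"
    using na n by (simp add: field_simps)
  have 3: "rising_step x (Suc i) \<alpha> = x * rising_step (x + \<alpha>) i \<alpha>"
    unfolding rising_step_def prod.lessThan_Suc_shift by (simp add: algebra_simps)
  have "real (Suc i) * U_coeff n \<alpha> (Suc i) x =
     (1 + real n * \<alpha>) powr (- x / \<alpha>) * inverse (\<alpha> + 1 / real n) ^ Suc i * rising_step x (Suc i) \<alpha> / fact i"
    using False by (simp add: U_coeff_def del: of_nat_Suc power_Suc)
  also have "\<dots> = ((1 + real n * \<alpha>) * inverse (\<alpha> + 1 / real n)) * x * 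
     ((1 + real n * \<alpha>) powr (- (x + \<alpha>) / \<alpha>) * inverse (\<alpha> + 1 / real n) ^ i * rising_step (x + \<alpha>) i \<alpha> / fact i)"
    unfolding 1 3 by simp
  also have "\<dots> = real n * x * U_coeff n \<alpha> i (x + \<alpha>)"
    unfolding 2 using False by (simp add: U_coeff_def)
  finally show ?thesis .
qed

text \<open>The factor \<open>i\<close> kills the term at 0, and the shift relation turns the rest
  into \<open>n * x\<close> times the total mass at x + \<alpha>.\<close>

lemma U_coeff_mean_sums:
  assumes n: "n \<ge> 1" and \<alpha>: "0 \<le> \<alpha>"
  shows "(\<lambda>i. real i * U_coeff n \<alpha> i x) sums (real n * x)"
proof -
  have "(\<lambda>i. real n * x * U_coeff n \<alpha> i (x + \<alpha>)) sums (real n * x * 1)"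
    by (intro sums_mult U_coeff_sums_1 assms)
  then have "(\<lambda>i. real (Suc i) * U_coeff n \<alpha> (Suc i) x) sums (real n * x)"
    by (simp only: U_coeff_Suc[OF assms] mult_1_right)
  then show ?thesis
    using sums_Suc[of "\<lambda>i. real i * U_coeff n \<alpha> i x"] by simp
qed

lemma U_coeff_second_moment_sums:
  assumes n: "n \<ge> 1" and \<alpha>: "0 \<le> \<alpha>"
  shows "(\<lambda>i. (real i)\<^sup>2 * U_coeff n \<alpha> i x) sums (real n * x * (real n * (x + \<alpha>) + 1))"
proof -
  have "(\<lambda>i. real n * x * (real i * U_coeff n \<alpha> i (x + \<alpha>) + U_coeff n \<alpha> i (x + \<alpha>))) sums
      (real n * x * (real n * (x + \<alpha>) + 1))"
    by (intro sums_mult sums_add U_coeff_sums_1 U_coeff_mean_sums assms)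
  \<comment> \<open>The shift relation multiplied by \<open>Suc i\<close>: the second moment at x
    becomes the mean plus the mass at x + \<alpha>.\<close>
  moreover have "real n * x * (real i * U_coeff n \<alpha> i (x + \<alpha>) + U_coeff n \<alpha> i (x + \<alpha>))
     = (real (Suc i))\<^sup>2 * U_coeff n \<alpha> (Suc i) x" for i
    using arg_cong[OF U_coeff_Suc[OF assms, of i x], of "\<lambda>t. real (Suc i) * t"]
    by (simp add: power2_eq_square algebra_simps)
  ultimately have "(\<lambda>i. (real (Suc i))\<^sup>2 * U_coeff n \<alpha> (Suc i) x) sums (real n * x * (real n * (x + \<alpha>) + 1))"
    by (simp only:)
  then show ?thesis
    using sums_Suc[of "\<lambda>i. (real i)\<^sup>2 * U_coeff n \<alpha> i x"] by simp
qed

section \<open>Averages over Erlang distributions\<close>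

lemma has_bochner_integral_erlang_moment:
  assumes "0 < l"
  shows "has_bochner_integral lborel (\<lambda>u. erlang_density k l u * u ^ i) (fact (k + i) / (fact k * l ^ i))"
proof (rule has_bochner_integral_nn_integral)
  show "(\<integral>\<^sup>+ u. ennreal (erlang_density k l u * u ^ i) \<partial>lborel) = ennreal (fact (k + i) / (fact k * l ^ i))"
    by (rule nn_integral_erlang_ith_moment[OF assms])
qed (use assms in \<open>auto simp: erlang_density_def\<close>)

text \<open>Expanding the square reduces this to the raw moments of order 0, 1 and 2, namely 1, (i +
  1) / l and (i + 1)(i + 2) / l^2.\<close>

lemma has_bochner_integral_erlang_quadratic:
  fixes a b c :: real
  assumes l: "0 < l"
  shows "has_bochner_integral lborel (\<lambda>u. erlang_density i l u * (a + b * (u - c)\<^sup>2))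
    (a + b * ((real i + 1) * (real i + 2) / l\<^sup>2 - 2 * c * (real i + 1) / l + c\<^sup>2))"
proof -
  note m = has_bochner_integral_erlang_moment[OF l]
  have "has_bochner_integral lborel
     (\<lambda>u. (a + b * c\<^sup>2) * (erlang_density i l u * u ^ 0) + (- 2 * b * c) * (erlang_density i l u * u ^ 1)
        + b * (erlang_density i l u * u ^ 2))
     ((a + b * c\<^sup>2) * (fact (i + 0) / (fact i * l ^ 0)) + (- 2 * b * c) * (fact (i + 1) / (fact i * l ^ 1))
        + b * (fact (i + 2) / (fact i * l ^ 2)))"
    by (intro has_bochner_integral_add has_bochner_integral_mult_right m)
  moreover have "(a + b * c\<^sup>2) * (fact (i + 0) / (fact i * l ^ 0)) + (- 2 * b * c) * (fact (i + 1) / (fact i * l ^ 1))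
        + b * (fact (i + 2) / (fact i * l ^ 2)) =
      a + b * ((real i + 1) * (real i + 2) / l\<^sup>2 - 2 * c * (real i + 1) / l + c\<^sup>2)"
  proof -
    have m1: "fact (i + 1) / (fact i * l ^ 1) = (real i + 1) / l"
      and m2: "fact (i + 2) / (fact i * l ^ 2) = (real i + 1) * (real i + 2) / l\<^sup>2"
      by (simp_all add: add.commute)
    have "(a + b * c\<^sup>2) * 1 + (- 2 * b * c) * A + b * B = a + b * (B - 2 * c * A + c\<^sup>2)" for A B
      by (simp add: algebra_simps)
    from this[of "(real i + 1) / l" "(real i + 1) * (real i + 2) / l\<^sup>2"] show ?thesis
      unfolding m1 m2 by simp
  qed
  moreover have "(\<lambda>u. (a + b * c\<^sup>2) * (erlang_density i l u * u ^ 0) + (- 2 * b * c) * (erlang_density i l u * u ^ 1)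
        + b * (erlang_density i l u * u ^ 2)) = (\<lambda>u. erlang_density i l u * (a + b * (u - c)\<^sup>2))"
    by (simp add: fun_eq_iff power2_eq_square algebra_simps)
  ultimately show ?thesis by (simp only:)
qed

text \<open>The density has mass 1, so \<open>y\<close> can be moved under the integral and the
  bound averaged. The same bound yields integrability.\<close>

lemma erlang_mean_bound:
  assumes cont: "continuous_on {0..} f" and l: "0 < l"
    and bound: "\<And>u. u \<ge> 0 \<Longrightarrow> \<bar>f u - y\<bar> \<le> a + b * (u - c)\<^sup>2"
  shows "\<bar>(LINT u|lborel. erlang_density i l u * f u) - y\<bar>
     \<le> a + b * ((real i + 1) * (real i + 2) / l\<^sup>2 - 2 * c * (real i + 1) / l + c\<^sup>2)"
proof -
  note E = has_bochner_integral_erlang_quadratic[OF l, of i]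
  have meas: "(\<lambda>u. erlang_density i l u * (f u - y)) \<in> borel_measurable lborel"
  proof -
    \<comment> \<open>Continuity is known on the half line only; as the density vanishes on negative
      arguments, cutting \<open>f\<close> off there changes nothing.\<close>
    have "(\<lambda>u. indicator {0..} u *\<^sub>R f u) \<in> borel_measurable borel"
      by (rule borel_measurable_continuous_on_indicator) (use cont in auto)
    then have "(\<lambda>u. erlang_density i l u * (indicator {0..} u *\<^sub>R f u - y)) \<in> borel_measurable lborel"
      by simp
    moreover have "(\<lambda>u. erlang_density i l u * (indicator {0..} u *\<^sub>R f u - y)) = (\<lambda>u. erlang_density i l u * (f u - y))"
      by (auto simp: fun_eq_iff erlang_density_def indicator_def)
    ultimately show ?thesis by (simp only:)
  qed
  have le: "\<bar>erlang_density i l u * (f u - y)\<bar> \<le> erlang_density i l u * (a + b * (u - c)\<^sup>2)" for u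
  proof (cases "u < 0")
    case False
    then show ?thesis
      using bound[of u] erlang_density_nonneg[of l i u] l by (auto simp: abs_mult intro!: mult_left_mono)
  qed (simp add: erlang_density_def)
  have int: "integrable lborel (\<lambda>u. erlang_density i l u * (f u - y))"
  proof (rule Bochner_Integration.integrable_bound[OF _ meas])
    show "integrable lborel (\<lambda>u. erlang_density i l u * (a + b * (u - c)\<^sup>2))"
      using E by (simp add: has_bochner_integral_iff)
    show "AE u in lborel. norm (erlang_density i l u * (f u - y)) \<le> norm (erlang_density i l u * (a + b * (u - c)\<^sup>2))"
      using le by (intro AE_I2) (metis abs_ge_self order_trans real_norm_def)
  qed
  have "has_bochner_integral lborel (\<lambda>u. erlang_density i l u) 1"
    using E[of 1 0 0] by simp
  then have y: "has_bochner_integral lborel (\<lambda>u. erlang_density i l u * y) y"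
    using has_bochner_integral_mult_left[of y lborel "erlang_density i l" 1] by simp
  have "has_bochner_integral lborel (\<lambda>u. erlang_density i l u * (f u - y) + erlang_density i l u * y)
     ((LINT u|lborel. erlang_density i l u * (f u - y)) + y)"
    by (intro has_bochner_integral_add y has_bochner_integral_integrable int)
  then have "(LINT u|lborel. erlang_density i l u * f u) - y = (LINT u|lborel. erlang_density i l u * (f u - y))"
    by (simp add: has_bochner_integral_iff algebra_simps)
  also have "\<bar>\<dots>\<bar> \<le> (LINT u|lborel. \<bar>erlang_density i l u * (f u - y)\<bar>)"
    by (rule integral_abs_bound)
  also have "\<dots> \<le> (LINT u|lborel. erlang_density i l u * (a + b * (u - c)\<^sup>2))"
    using le int E by (intro integral_mono integrable_abs) (auto simp: has_bochner_integral_iff)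
  also have "\<dots> = a + b * ((real i + 1) * (real i + 2) / l\<^sup>2 - 2 * c * (real i + 1) / l + c\<^sup>2)"
    using E by (rule has_bochner_integral_integral_eq)
  finally show ?thesis .
qed

section \<open>Second central moment and pointwise error of the operator\<close>

lemma U_coeff_central_moment_sums:
  assumes n: "n \<ge> 1" and \<alpha>: "0 \<le> \<alpha>"
  shows "(\<lambda>i. U_coeff n \<alpha> i x * (a + b * ((real i + 1) * (real i + 2) / (real n)\<^sup>2 - 2 * x * (real i + 1) / real n + x\<^sup>2)))
    sums (a + b * (\<alpha> * x + 2 * x / real n + 2 / (real n)\<^sup>2))"
proof -
  define p where "p = (\<lambda>i. U_coeff n \<alpha> i x)"
  \<comment> \<open>The Erlang mean of the quadratic, regrouped by powers of \<open>i\<close> so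
    that the three known moments apply.\<close>
  have "(\<lambda>i. (b / (real n)\<^sup>2) * ((real i)\<^sup>2 * p i) + (b * (3 / (real n)\<^sup>2 - 2 * x / real n)) * (real i * p i)
        + (a + b * (2 / (real n)\<^sup>2 - 2 * x / real n + x\<^sup>2)) * p i)
    sums ((b / (real n)\<^sup>2) * (real n * x * (real n * (x + \<alpha>) + 1))
      + (b * (3 / (real n)\<^sup>2 - 2 * x / real n)) * (real n * x)
      + (a + b * (2 / (real n)\<^sup>2 - 2 * x / real n + x\<^sup>2)) * 1)"
    unfolding p_def
    by (intro sums_add sums_mult U_coeff_sums_1 U_coeff_mean_sums U_coeff_second_moment_sums assms)
  also have "(\<lambda>i. (b / (real n)\<^sup>2) * ((real i)\<^sup>2 * p i) + (b * (3 / (real n)\<^sup>2 - 2 * x / real n)) * (real i * p i)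
        + (a + b * (2 / (real n)\<^sup>2 - 2 * x / real n + x\<^sup>2)) * p i) =
     (\<lambda>i. p i * (a + b * ((real i + 1) * (real i + 2) / (real n)\<^sup>2 - 2 * x * (real i + 1) / real n + x\<^sup>2)))"
    using n by (auto simp: power2_eq_square field_simps)
  also have "(b / (real n)\<^sup>2) * (real n * x * (real n * (x + \<alpha>) + 1))
      + (b * (3 / (real n)\<^sup>2 - 2 * x / real n)) * (real n * x)
      + (a + b * (2 / (real n)\<^sup>2 - 2 * x / real n + x\<^sup>2)) * 1
      = a + b * (\<alpha> * x + 2 * x / real n + 2 / (real n)\<^sup>2)"
    using n by (simp add: power2_eq_square field_simps)
  finally show ?thesis by (simp add: p_def)
qed

text \<open>The prefactor \<open>real n\<close> completes each kernel to the Erlang density of shape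
  \<open>i + 1\<close>; summability allows it to pass through the series.\<close>

lemma U_op_erlang:
  assumes n: "n \<ge> 1"
    and s: "summable (\<lambda>i. U_coeff n \<alpha> i x * (LINT u|lborel. erlang_density i (real n) u * f u))"
  shows "U_op n \<alpha> f x = (\<Sum>i. U_coeff n \<alpha> i x * (LINT u|lborel. erlang_density i (real n) u * f u))"
proof -
  have "real n * (LINT u:{0..}|lborel. exp (- (real n * u)) * (real n * u) ^ i / fact i * f u) =
    (LINT u|lborel. erlang_density i (real n) u * f u)" for i
    unfolding set_lebesgue_integral_def integral_mult_right_zero[symmetric]
    by (intro Bochner_Integration.integral_cong)
       (auto simp: erlang_density_def indicator_def power_mult_distrib field_simps)
  then have eq: "(LINT u:{0..}|lborel. exp (- (real n * u)) * (real n * u) ^ i / fact i * f u) =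
    (LINT u|lborel. erlang_density i (real n) u * f u) / real n" for i
    using n by (simp add: field_simps)
  show ?thesis
    unfolding U_op_def eq using n suminf_divide[OF s, of "real n"] by simp
qed

text \<open>Since the coefficients are non-negative with sum 1, the Erlang error bounds can be
  averaged termwise; their sum is the second central moment.\<close>

lemma U_op_bound:
  assumes cont: "continuous_on {0..} f" and n: "n \<ge> 1" and \<alpha>: "0 \<le> \<alpha>" and x: "0 \<le> x"
    and bound: "\<And>u. u \<ge> 0 \<Longrightarrow> \<bar>f u - f x\<bar> \<le> a + b * (u - x)\<^sup>2"
  shows "\<bar>U_op n \<alpha> f x - f x\<bar> \<le> a + b * (\<alpha> * x + 2 * x / real n + 2 / (real n)\<^sup>2)"
proof -
  define p where "p = (\<lambda>i. U_coeff n \<alpha> i x)"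
  define e where "e = (\<lambda>i. LINT u|lborel. erlang_density i (real n) u * f u)"
  define m where "m = (\<lambda>i. a + b * ((real i + 1) * (real i + 2) / (real n)\<^sup>2 - 2 * x * (real i + 1) / real n + x\<^sup>2))"
  have m: "(\<lambda>i. p i * m i) sums (a + b * (\<alpha> * x + 2 * x / real n + 2 / (real n)\<^sup>2))"
    unfolding p_def m_def by (rule U_coeff_central_moment_sums[OF n \<alpha>])
  have em: "\<bar>e i - f x\<bar> \<le> m i" for i
    unfolding e_def m_def using n by (intro erlang_mean_bound cont bound) auto
  have le: "norm (p i * (e i - f x)) \<le> p i * m i" for i
    using em[of i] U_coeff_nonneg[OF \<alpha> x, of n i] by (auto simp: abs_mult p_def intro!: mult_left_mono)
  \<comment> \<open>Convergence is obtained for the deviations first; adding the series with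
    constant factor \<open>f x\<close> gives that of the operator itself.\<close>
  have s: "summable (\<lambda>i. p i * (e i - f x))"
    by (rule summable_comparison_test'[OF sums_summable[OF m]]) (rule le)
  have y: "(\<lambda>i. p i * f x) sums f x"
    using sums_mult2[OF U_coeff_sums_1[OF n \<alpha>, of x], of "f x"] by (simp add: p_def)
  have "(\<lambda>i. p i * e i) sums ((\<Sum>i. p i * (e i - f x)) + f x)"
    using sums_add[OF summable_sums[OF s] y] by (simp add: algebra_simps)
  then have "U_op n \<alpha> f x = (\<Sum>i. p i * (e i - f x)) + f x"
    using U_op_erlang[OF n, of \<alpha> x f] by (simp add: p_def e_def sums_iff)
  moreover have "norm (\<Sum>i. p i * (e i - f x)) \<le> (\<Sum>i. p i * m i)"
    by (rule norm_suminf_le[OF le sums_summable[OF m]])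
  ultimately show ?thesis
    using sums_unique[OF m] by simp
qed

section \<open>Convergence in the weighted norm, uniformly in the parameter\<close>

lemma w_norm_U_op_le:
  assumes f: "f \<in> C_w_k" and \<epsilon>: "\<epsilon> > 0"
  shows "\<exists>N. \<forall>n\<ge>N. \<forall>\<alpha>. 0 \<le> \<alpha> \<and> \<alpha> \<le> 1 / real n \<longrightarrow> w_norm (\<lambda>x. U_op n \<alpha> f x - f x) \<le> ereal \<epsilon>"
proof -
  have cont: "continuous_on {0..} f" using f by (simp add: C_w_k_def)
  obtain K where K: "K \<ge> 0"
    and fK: "\<And>u x. u \<ge> 0 \<Longrightarrow> x \<ge> 0 \<Longrightarrow> \<bar>f u - f x\<bar> \<le> \<epsilon> / 2 * w x + K * (u - x)\<^sup>2"
    using weighted_modulus[OF f, of "\<epsilon> / 2"] \<epsilon> by auto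
  \<comment> \<open>The bound 1 keeps \<open>n\<close> positive; the other one gives 5 K / n \<le>
    \<epsilon> / 2.\<close>
  obtain N where N: "real N \<ge> max 1 (10 * K / \<epsilon>)"
    using real_arch_simple by blast
  have "w_norm (\<lambda>x. U_op n \<alpha> f x - f x) \<le> ereal \<epsilon>" if "n \<ge> N" "0 \<le> \<alpha>" "\<alpha> \<le> 1 / real n" for n \<alpha>
    unfolding w_norm_def
  proof (rule SUP_least)
    fix x :: real assume "x \<in> {0..}"
    then have x: "x \<ge> 0" by simp
    have "real N \<le> real n" using that by simp
    then have n: "real n \<ge> 1" "10 * K / \<epsilon> \<le> real n" using N by auto
    have "0 \<le> (x - 1)\<^sup>2" by simp
    then have xw: "2 * x \<le> w x" by (simp add: w_def power2_eq_square algebra_simps)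
    have "real n * 1 \<le> real n * real n" using n by (intro mult_left_mono) auto
    then have "2 / (real n)\<^sup>2 \<le> 2 / real n"
      using n by (intro divide_left_mono) (auto simp: power2_eq_square)
    then have "\<alpha> * x + 2 * x / real n + 2 / (real n)\<^sup>2 \<le> 1 / real n * x + 2 * x / real n + 2 / real n"
      using x that by (intro add_mono mult_right_mono) auto
    also have "\<dots> = (3 * x + 2) / real n" using n by (simp add: field_simps)
    also have "\<dots> \<le> 5 * w x / real n"
      using xw w_ge_1[of x] n x by (intro divide_right_mono) auto
    finally have "K * (\<alpha> * x + 2 * x / real n + 2 / (real n)\<^sup>2) \<le> K * (5 * w x / real n)"
      using K by (rule mult_left_mono)
    also have "\<dots> = (5 * K / real n) * w x" by simp
    also have "\<dots> \<le> \<epsilon> / 2 * w x"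
      using n \<epsilon> w_pos[of x] by (intro mult_right_mono) (auto simp: field_simps)
    finally have "K * (\<alpha> * x + 2 * x / real n + 2 / (real n)\<^sup>2) \<le> \<epsilon> / 2 * w x" .
    moreover have "\<bar>U_op n \<alpha> f x - f x\<bar> \<le> \<epsilon> / 2 * w x + K * (\<alpha> * x + 2 * x / real n + 2 / (real n)\<^sup>2)"
      using n x that by (intro U_op_bound cont fK) auto
    ultimately have "\<bar>U_op n \<alpha> f x - f x\<bar> \<le> \<epsilon> / 2 * w x + \<epsilon> / 2 * w x"
      by (meson add_left_mono order_trans)
    then have "\<bar>U_op n \<alpha> f x - f x\<bar> \<le> \<epsilon> * w x" by simp
    then show "ereal (\<bar>U_op n \<alpha> f x - f x\<bar> / w x) \<le> ereal \<epsilon>"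
      using w_pos[of x] by (simp add: divide_le_eq)
  qed
  then show ?thesis by blast
qed

section \<open>From ordinary to statistical convergence\<close>

lemma w_norm_nonneg: "0 \<le> w_norm f"
  unfolding w_norm_def by (rule SUP_upper2[of 0]) (auto simp: w_def)

text \<open>Regularity is tested on the unit sequence at \<open>i\<close>, a null sequence whose
  transform is the column itself.\<close>

lemma regular_summability_matrix_column:
  assumes A: "regular_summability_matrix A" and i: "1 \<le> i"
  shows "(\<lambda>n. A n i) \<longlonglongrightarrow> 0"
proof -
  define x :: "nat \<Rightarrow> real" where "x = (\<lambda>j. if j = i then 1 else 0)"
  have "eventually (\<lambda>j. x j = 0) sequentially"
    using eventually_gt_at_top[of i] by eventually_elim (simp add: x_def)
  then have "x \<longlonglongrightarrow> 0" by (rule tendsto_eventually)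
  then have "(\<lambda>n. \<Sum>j. A n (Suc j) * x (Suc j)) \<longlonglongrightarrow> 0"
    using A unfolding regular_summability_matrix_def by blast
  moreover have "(\<Sum>j. A n (Suc j) * x (Suc j)) = A n i" for n
  proof -
    have "(\<Sum>j. A n (Suc j) * x (Suc j)) = (\<Sum>j\<in>{i - 1}. A n (Suc j) * x (Suc j))"
      using i by (intro suminf_finite) (auto simp: x_def)
    then show ?thesis using i by (simp add: x_def)
  qed
  ultimately show ?thesis by simp
qed

theorem theorem7p1:
  fixes A :: "nat \<Rightarrow> nat \<Rightarrow> real" and \<alpha> :: "nat \<Rightarrow> real" and f :: "real \<Rightarrow> real"
  assumes "regular_summability_matrix A"
    and "\<And>n. 1 \<le> n \<Longrightarrow> 0 \<le> \<alpha> n \<and> \<alpha> n \<le> 1 / real n"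
    and "f \<in> C_w_k"
  shows "A_stat_lim A (\<lambda>n. w_norm (\<lambda>x. U_op n (\<alpha> n) f x - f x)) 0"
  unfolding A_stat_lim_def
proof (intro allI impI)
  fix \<epsilon> :: real assume \<epsilon>: "\<epsilon> > 0"
  define S where "S = {i. 1 \<le> i \<and> ereal \<epsilon> \<le> \<bar>w_norm (\<lambda>x. U_op i (\<alpha> i) f x - f x) - ereal 0\<bar>}"
  \<comment> \<open>Half of \<epsilon> is used because the exceptional set includes norms equal to
    \<epsilon>.\<close>
  obtain N where N: "\<And>n a. n \<ge> N \<Longrightarrow> 0 \<le> a \<Longrightarrow> a \<le> 1 / real n \<Longrightarrow>
      w_norm (\<lambda>x. U_op n a f x - f x) \<le> ereal (\<epsilon> / 2)"
    using w_norm_U_op_le[OF assms(3), of "\<epsilon> / 2"] \<epsilon> by auto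
  have "S \<subseteq> {..<N}"
  proof
    fix i assume i: "i \<in> S"
    show "i \<in> {..<N}"
    proof (rule ccontr)
      assume "i \<notin> {..<N}"
      then have "w_norm (\<lambda>x. U_op i (\<alpha> i) f x - f x) \<le> ereal (\<epsilon> / 2)"
        using i assms(2)[of i] by (intro N) (auto simp: S_def)
      moreover have "ereal \<epsilon> \<le> w_norm (\<lambda>x. U_op i (\<alpha> i) f x - f x)"
        using i w_norm_nonneg by (simp add: S_def abs_ereal_pos flip: zero_ereal_def)
      ultimately have "ereal \<epsilon> \<le> ereal (\<epsilon> / 2)" by (rule order_trans[rotated])
      then show False using \<epsilon> by simp
    qed
  qed
  \<comment> \<open>Over a finite index set the infinite sum is a finite sum of columns, each
    tending to 0.\<close>
  then have "finite S" by (rule finite_subset) simp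
  moreover have "(\<lambda>n. \<Sum>i\<in>S. A n i) \<longlonglongrightarrow> 0"
    by (intro tendsto_null_sum regular_summability_matrix_column[OF assms(1)]) (auto simp: S_def)
  ultimately show "(\<lambda>n. \<Sum>\<^sub>\<infinity>i\<in>{i. 1 \<le> i \<and> ereal \<epsilon> \<le> \<bar>w_norm (\<lambda>x. U_op i (\<alpha> i) f x - f x) - ereal 0\<bar>}. A n i) \<longlonglongrightarrow> 0"
    unfolding S_def[symmetric] by simp
qed

end
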